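(* Let $\alpha$ and $\beta$ be two irrational real numbers satisfying $\alpha\pm\beta\notin\mathbb{Z}$ (that is, $\alpha+\beta\notin\mathbb{Z}$ and $\alpha-\beta\notin\mathbb{Z}$). If at least one of the numbers $\alpha$ or $\beta$ is not equivalent to $\tau=\frac{\sqrt5+1}{2}$, then $$C_{\alpha,\beta}\ \geq\ C_2,\qquad\text{where } C_2=\sqrt{\sqrt2+1}-1 .$$
   Context: For an irrational $\alpha\in\mathbb{R}$ and real $x\ge 1$, the irrationality measure function is $\psi_\alpha(x)=\min_{1\le q\le x,\ q\in\mathbb{Z}}\|q\alpha\|$, where $\|\cdot\|$ denotes the distance to the nearest integer. For irrational $\alpha,\beta$ with $\alpha\pm\beta\notin\mathbb{Z}$ define $$C_{\alpha,\beta}=\sup\{C:\ |\psi_\alpha(t)-\psi_\beta(t)|\ge C\cdot\min(\psi_\alpha(t),\psi_\beta(t))\ \text{for infinitely many } t\in\mathbb{N}\},$$ where the supremum is taken over real numbers $C$ (the value $+\infty$ is allowed). For an irrational $\alpha$ with continued fraction expansion $\alpha=[a_0;a_1,a_2,\ldots]$ write $\alpha_r=[a_r;a_{r+1},a_{r+2},\ldots]$ for its tails. Two irrational numbers $\alpha$ and $\beta$ are called equivalent if there exist $n,m\in\mathbb{N}$ such that $\alpha_n=\beta_m$. *)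

theory Defs
  imports Complex_Main "HOL-Library.Extended_Real"
begin

definition dist_int :: "real \<Rightarrow> real" where
  "dist_int x = \<bar>x - of_int (round x)\<bar>"

text \<open>Meaningful only for \<open>x \<ge> 1\<close>; otherwise the minimum is over the empty set.\<close>

definition irr_measure :: "real \<Rightarrow> real \<Rightarrow> real" where
  "irr_measure \<alpha> x = Min ((\<lambda>q. dist_int (of_int q * \<alpha>)) ` {q::int. 1 \<le> q \<and> of_int q \<le> x})"

definition C_const :: "real \<Rightarrow> real \<Rightarrow> ereal" where
  "C_const \<alpha> \<beta> = (SUP C \<in> {C::real. infinite {t::nat. 1 \<le> t \<and>
      \<bar>irr_measure \<alpha> (real t) - irr_measure \<beta> (real t)\<bar>
        \<ge> C * min (irr_measure \<alpha> (real t)) (irr_measure \<beta> (real t))}}. ereal C)"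

text \<open>
  The continued fraction algorithm. For irrational \<open>\<alpha>\<close> it never divides by zero, and
  \<open>cf_digit \<alpha> r\<close> is the partial quotient \<open>a\<^sub>r\<close>; rational inputs are not of interest.
\<close>

primrec cf_remainder :: "real \<Rightarrow> nat \<Rightarrow> real" where
  "cf_remainder \<alpha> 0 = \<alpha>"
| "cf_remainder \<alpha> (Suc r) = 1 / frac (cf_remainder \<alpha> r)"

definition cf_digit :: "real \<Rightarrow> nat \<Rightarrow> int" where
  "cf_digit \<alpha> r = \<lfloor>cf_remainder \<alpha> r\<rfloor>"

text \<open>\<open>cf_finite n a\<close> is \<open>[a\<^sub>0; a\<^sub>1, \<dots>, a\<^sub>n]\<close>, and \<open>cf_value a\<close> is \<open>[a\<^sub>0; a\<^sub>1, a\<^sub>2, \<dots>]\<close>.\<close>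

primrec cf_finite :: "nat \<Rightarrow> (nat \<Rightarrow> int) \<Rightarrow> real" where
  "cf_finite 0 a = of_int (a 0)"
| "cf_finite (Suc n) a = of_int (a 0) + 1 / cf_finite n (\<lambda>i. a (Suc i))"

definition cf_value :: "(nat \<Rightarrow> int) \<Rightarrow> real" where
  "cf_value a = lim (\<lambda>n. cf_finite n a)"

definition cf_tail :: "real \<Rightarrow> nat \<Rightarrow> real" where
  "cf_tail \<alpha> r = cf_value (\<lambda>i. cf_digit \<alpha> (r + i))"

definition cf_equivalent :: "real \<Rightarrow> real \<Rightarrow> bool" where
  "cf_equivalent \<alpha> \<beta> \<longleftrightarrow> (\<exists>n m. cf_tail \<alpha> n = cf_tail \<beta> m)"

definition golden :: real where
  "golden = (sqrt 5 + 1) / 2"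

end

theory Submission
  imports Defs
begin

text \<open>
  Let \<open>K = sqrt (sqrt 2 + 1)\<close> and suppose that the ratio of the two measure functions stays strictly
  between \<open>1 / K\<close> and \<open>K\<close> from some point on. At a convergent denominator of one number that is not
  a denominator of the other only one function jumps, so it drops by a factor less than
  \<open>K\<^sup>2 = 1 + sqrt 2 = [2; 2, 2, \<dots>]\<close>. Hence the corresponding partial quotient is \<open>1\<close>, or it is \<open>2\<close> and
  the next drop exceeds \<open>K\<^sup>2\<close>, so the next denominator is common to both numbers.
  Between two successive common denominators the partial quotients are therefore almost all \<open>1\<close>, so
  the two sequences of denominators interlace in Fibonacci fashion; they can meet again only through
  a final partial quotient \<open>2\<close> in exactly one of them, or very close to the first meeting, and each of
  these possibilities violates the bound on the ratio. So common denominators do not recur, all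
  partial quotients of both numbers are eventually \<open>1\<close>, and both numbers are equivalent to \<open>golden\<close>.
\<close>

section \<open>Sequences of best approximations\<close>

text \<open>An abstract convergent sequence: \<open>q n\<close> are the denominators,
  \<open>xi n\<close> the distances of their multiples from the integers, and \<open>a n\<close> the
  partial quotient leading to \<open>q (Suc (Suc n))\<close>. The identity \<open>xi_q\<close> is
  the determinant relation of neighbouring convergents.\<close>

locale approx_seq =
  fixes q :: "nat \<Rightarrow> int" and xi :: "nat \<Rightarrow> real" and a :: "nat \<Rightarrow> int"
  assumes q_pos: "0 < q n" and q_less: "q n < q (Suc n)" and a_pos: "1 \<le> a n"
    and q_rec: "q (Suc (Suc n)) = a n * q (Suc n) + q n"
    and xi_pos: "0 < xi n" and xi_less: "xi (Suc n) < xi n"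
    and xi_rec: "xi n = of_int (a n) * xi (Suc n) + xi (Suc (Suc n))"
    and xi_q: "xi n * of_int (q (Suc n)) + xi (Suc n) * of_int (q n) = 1"
begin

lemma q_strict_mono: "strict_mono q"
  using q_less by (simp add: strict_mono_Suc_iff)

lemma q_ge: "int n + q 0 \<le> q n"
proof (induction n)
  case (Suc n)
  then show ?case using q_less[of n] by simp
qed simp

lemma q_rec_ge: "q (Suc n) + q n \<le> q (Suc (Suc n))"
  using mult_right_mono[OF a_pos[of n], of "q (Suc n)"] q_pos[of "Suc n"] by (simp add: q_rec)

lemma xi_rec_ge: "xi (Suc n) + xi (Suc (Suc n)) \<le> xi n"
  using mult_right_mono[of 1 "of_int (a n)" "xi (Suc n)"] a_pos[of n] xi_pos[of "Suc n"]
  by (subst xi_rec[of n]) simp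

lemma gap:
  assumes "q 0 \<le> t"
  obtains n where "q n \<le> t" "t < q (Suc n)"
proof -
  have ex: "\<exists>n. t < q n"
    using q_ge[of "nat t + 1"] q_pos[of 0] by (intro exI[of _ "nat t + 1"]) linarith
  define N where "N = (LEAST n. t < q n)"
  have N: "t < q N" unfolding N_def using ex by (rule LeastI_ex)
  with assms have "N \<noteq> 0" by (metis not_le)
  then obtain n where n: "N = Suc n" by (cases N) auto
  then have "\<not> t < q n" using not_less_Least[of n "\<lambda>n. t < q n"] by (simp add: N_def)
  with N n show thesis by (intro that[of n]) auto
qed

text \<open>The ratio \<open>xi n / xi (Suc n)\<close> is \<open>a n\<close> plus the reciprocal of
  the next ratio, and \<open>1 + sqrt 2 = 2 + 1 / (1 + sqrt 2)\<close>. With digit 2, a ratio below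
  \<open>1 + sqrt 2\<close> therefore forces the next one above it.\<close>

lemma small_jump_digit:
  assumes "xi n < (1 + sqrt 2) * xi (Suc n)"
  shows "a n = 1 \<or> a n = 2 \<and> (1 + sqrt 2) * xi (Suc (Suc n)) < xi (Suc n)"
proof (cases "a n \<ge> 2")
  case True
  have s: "1 < sqrt 2" "sqrt 2 < 2" by (auto intro: real_less_lsqrt)
  have "\<not> a n \<ge> 3"
  proof
    assume "a n \<ge> 3"
    then have "3 * xi (Suc n) \<le> of_int (a n) * xi (Suc n)"
      using xi_pos[of "Suc n"] by (intro mult_right_mono) auto
    moreover have "(1 + sqrt 2) * xi (Suc n) \<le> 3 * xi (Suc n)"
      using s xi_pos[of "Suc n"] by (intro mult_right_mono) auto
    ultimately show False
      using assms xi_rec[of n] xi_pos[of "Suc (Suc n)"] by linarith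
  qed
  with True have 2: "a n = 2" by simp
  then have "xi (Suc (Suc n)) < (sqrt 2 - 1) * xi (Suc n)"
    using assms xi_rec[of n] by (simp add: algebra_simps)
  then have "(1 + sqrt 2) * xi (Suc (Suc n)) < (1 + sqrt 2) * ((sqrt 2 - 1) * xi (Suc n))"
    using s by (intro mult_strict_left_mono) linarith+
  also have "\<dots> = xi (Suc n)" by (simp add: algebra_simps)
  finally show ?thesis using 2 by simp
next
  case False
  then show ?thesis using a_pos[of n] by linarith
qed

end

section \<open>Two balanced sequences have few common denominators\<close>

definition crit :: real where "crit = sqrt (sqrt 2 + 1)"

lemma crit_sq: "crit * crit = 1 + sqrt 2"
  by (simp add: crit_def)

lemma crit_bounds: "1 < crit" "crit < 777 / 500"
proof -
  \<comment> \<open>\<open>crit\<close> is about 1.5538, so 1.554 is a close rational upper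
    bound.\<close>
  have "sqrt 2 < 14149 / 10000" by (rule real_less_lsqrt) (auto simp: power2_eq_square)
  then show "crit < 777 / 500" unfolding crit_def
    by (intro real_less_lsqrt) (auto simp: power2_eq_square)
  show "1 < crit" by (simp add: crit_def)
qed

text \<open>\<open>balance\<close> keeps the two measure functions within a factor
  \<open>crit\<close> beyond \<open>T\<close>. For large \<open>T\<close>, \<open>incong\<close>
  encodes that neither the sum nor the difference of the two numbers is an integer.\<close>

locale approx_pair = A: approx_seq q xi a + B: approx_seq s eta b
  for q xi a s eta b +
  fixes T :: int
  assumes T_ge: "q 0 \<le> T" "s 0 \<le> T"
    and balance: "T \<le> t \<Longrightarrow> q n \<le> t \<Longrightarrow> t < q (Suc n) \<Longrightarrow> s m \<le> t \<Longrightarrow> t < s (Suc m)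
      \<Longrightarrow> xi n < crit * eta m \<and> eta m < crit * xi n"
    and incong: "q n = s m \<Longrightarrow> T \<le> q n \<Longrightarrow> \<not> q n dvd q (Suc n) - s (Suc m)"
begin

lemma swap: "approx_pair s eta b q xi a T"
proof
  show "\<not> s n dvd s (Suc n) - q (Suc m)" if "s n = q m" "T \<le> s n" for n m
    using incong[of m n] that by (metis dvd_diff_commute)
qed (use T_ge balance in blast)+

section \<open>Jumps of one sequence inside a gap of the other\<close>

lemma isolated_jump_small:
  assumes "T < q (Suc n)" "q (Suc n) \<notin> range s"
  shows "xi n < (1 + sqrt 2) * xi (Suc n)"
proof -
  \<comment> \<open>The times \<open>q (Suc n) - 1\<close> and \<open>q (Suc n)\<close> lie in one
    gap of \<open>s\<close>, so both are compared with the same \<open>eta m\<close> and the two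
    bounds multiply to \<open>crit * crit\<close>.\<close>
  obtain m where m: "s m \<le> q (Suc n) - 1" "q (Suc n) - 1 < s (Suc m)"
    using B.gap[of "q (Suc n) - 1"] T_ge assms(1) by auto
  with assms(2) have m': "q (Suc n) < s (Suc m)"
    by (metis add.commute diff_add_cancel order_le_less rangeI zless_imp_add1_zle)
  have "xi n < crit * eta m"
    using balance[of "q (Suc n) - 1" n m] m assms(1) A.q_less[of n] by auto
  also have "\<dots> < crit * (crit * xi (Suc n))"
    using balance[of "q (Suc n)" "Suc n" m] m m' assms(1) A.q_less[of "Suc n"] crit_bounds
    by (intro mult_strict_left_mono) auto
  also have "\<dots> = (1 + sqrt 2) * xi (Suc n)" by (simp add: crit_sq flip: mult.assoc)
  finally show ?thesis .
qed

lemma isolated_jump_digit: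
  assumes "T < q (Suc n)" "q (Suc n) \<notin> range s"
  shows "a n = 1 \<or> a n = 2 \<and> q (Suc (Suc n)) \<in> range s"
  using A.small_jump_digit[OF isolated_jump_small[OF assms]]
    isolated_jump_small[of "Suc n"] A.q_less[of "Suc n"] assms by fastforce

text \<open>Two drops of \<open>xi\<close> while \<open>eta\<close> stays constant again lose a factor less than \<open>1 + sqrt 2\<close>.\<close>

lemma double_jump:
  assumes "T \<le> q n" "s m \<le> q n" "q (Suc (Suc n)) < s (Suc m)"
  shows "a (Suc n) = 1" "(1 + sqrt 2) * xi (Suc (Suc (Suc n))) < xi (Suc (Suc n))"
    "q (Suc (Suc (Suc n))) \<in> range s"
proof -
  have s: "1 < sqrt 2" "sqrt 2 < 2" by (auto intro: real_less_lsqrt)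
  note less = A.q_less[of n] A.q_less[of "Suc n"] A.q_less[of "Suc (Suc n)"]
  have "xi n < crit * eta m"
    using balance[of "q n" n m] assms less by auto
  also have "\<dots> < crit * (crit * xi (Suc (Suc n)))"
    using balance[of "q (Suc (Suc n))" "Suc (Suc n)" m] assms less crit_bounds
    by (intro mult_strict_left_mono) auto
  also have "\<dots> = (1 + sqrt 2) * xi (Suc (Suc n))" by (simp add: crit_sq flip: mult.assoc)
  finally have 1: "xi n < (1 + sqrt 2) * xi (Suc (Suc n))" .
  \<comment> \<open>As \<open>xi n\<close> is at least \<open>xi (Suc n) + xi (Suc (Suc n))\<close>,
    such a digit would make the total drop exceed 3.\<close>
  have 2: "\<not> a (Suc n) \<ge> 2"
  proof
    assume "a (Suc n) \<ge> 2"
    then have "2 * xi (Suc (Suc n)) \<le> of_int (a (Suc n)) * xi (Suc (Suc n))"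
      using A.xi_pos[of "Suc (Suc n)"] by (intro mult_right_mono) auto
    moreover have "(1 + sqrt 2) * xi (Suc (Suc n)) < 3 * xi (Suc (Suc n))"
      using s A.xi_pos[of "Suc (Suc n)"] by (intro mult_strict_right_mono) auto
    ultimately show False
      using 1 A.xi_rec[of "Suc n"] A.xi_rec_ge[of n] A.xi_pos[of "Suc (Suc (Suc n))"] by linarith
  qed
  then show a1: "a (Suc n) = 1" using A.a_pos[of "Suc n"] by linarith
  have "xi (Suc (Suc (Suc n))) < (sqrt 2 - 1) * xi (Suc (Suc n))"
    using 1 A.xi_rec[of "Suc n"] A.xi_rec_ge[of n] a1 by (simp add: algebra_simps)
  then have "(1 + sqrt 2) * xi (Suc (Suc (Suc n))) < (1 + sqrt 2) * ((sqrt 2 - 1) * xi (Suc (Suc n)))"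
    using s by (intro mult_strict_left_mono) linarith+
  also have "\<dots> = xi (Suc (Suc n))" by (simp add: algebra_simps)
  finally show 3: "(1 + sqrt 2) * xi (Suc (Suc (Suc n))) < xi (Suc (Suc n))" .
  show "q (Suc (Suc (Suc n))) \<in> range s"
    using isolated_jump_small[of "Suc (Suc n)"] 3 assms less by fastforce
qed

section \<open>Meetings of the two sequences\<close>

text \<open>With \<open>Q\<close> the meeting point and \<open>v = s (Suc m)\<close>, one has
  \<open>xi n * Q \<ge> 2\<close> and \<open>eta m * Q \<le> 2 * Q / (Q + v)\<close>, so
  \<open>xi n / eta m\<close> is at least \<open>1 + v / Q\<close>. The bound 11/14 on
  \<open>s m / v\<close> gives \<open>v / Q \<ge> 14 / 25\<close>, and 1.56 exceeds
  \<open>crit\<close>.\<close>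

lemma no_meeting_two_one:
  assumes Q: "q (Suc (Suc n)) = s (Suc (Suc m))"
    and a: "a n = 2" and b: "b m = 1" and sm: "14 * s m \<le> 11 * s (Suc m)"
    and t: "T \<le> t" "q n \<le> t" "t < q (Suc n)" "s m \<le> t" "t < s (Suc m)"
  shows False
proof -
  define Q where "Q = real_of_int (s (Suc (Suc m)))"
  define u where "u = real_of_int (q (Suc n))"
  define v where "v = real_of_int (s (Suc m))"
  have Qpos: "0 < Q" using B.q_pos by (simp add: Q_def)
  have vpos: "0 < v" using B.q_pos by (simp add: v_def)
  have uQ: "2 * u \<le> Q"
    using A.q_rec[of n] a Q A.q_pos[of n] by (simp add: Q_def u_def)
  have "real_of_int (14 * s (Suc (Suc m))) \<le> real_of_int (25 * s (Suc m))"
    unfolding of_int_le_iff using B.q_rec[of m] b sm by simp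
  then have vQ: "14 * Q \<le> 25 * v" by (simp add: Q_def v_def)
  have vQ': "v < Q" using B.q_less[of "Suc m"] by (simp add: Q_def v_def)
  have x: "xi (Suc n) * Q + xi (Suc (Suc n)) * u = 1"
    using A.xi_q[of "Suc n"] Q by (simp add: Q_def u_def)
  have e: "eta (Suc m) * Q + eta (Suc (Suc m)) * v = 1"
    using B.xi_q[of "Suc m"] by (simp add: Q_def v_def)
  \<comment> \<open>By \<open>x\<close> and the recursion,
    \<open>xi n * Q = 2 + xi (Suc (Suc n)) * (Q - 2 * u)\<close>.\<close>
  have "xi (Suc (Suc n)) * (2 * u) \<le> xi (Suc (Suc n)) * Q"
    using uQ A.xi_pos[of "Suc (Suc n)"] by (intro mult_left_mono) auto
  then have X: "2 \<le> xi n * Q"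
    using x A.xi_rec[of n] a by (simp add: algebra_simps)
  have e2: "eta (Suc (Suc m)) * (Q + v) \<le> 1"
    using e mult_right_mono[of "eta (Suc (Suc m))" "eta (Suc m)" Q] B.xi_less[of "Suc m"] Qpos
    by (simp only: distrib_left) linarith
  have "eta m * Q = 1 + eta (Suc (Suc m)) * (Q - v)"
    using e B.xi_rec[of m] b by (simp add: algebra_simps)
  then have "eta m * Q * (Q + v) = (1 + eta (Suc (Suc m)) * (Q - v)) * (Q + v)"
    by (simp only:)
  also have "\<dots> = (Q + v) + (eta (Suc (Suc m)) * (Q + v)) * (Q - v)"
    by (simp add: algebra_simps)
  also have "\<dots> \<le> (Q + v) + 1 * (Q - v)"
    using e2 vQ' by (intro add_left_mono mult_right_mono) auto
  finally have E: "eta m * Q * (Q + v) \<le> 2 * Q" by simp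
  have "2 * (Q + v) \<le> xi n * Q * (Q + v)"
    using X Qpos vpos by (intro mult_right_mono) auto
  also have "\<dots> < crit * eta m * Q * (Q + v)"
    using balance[OF t] Qpos vpos by (intro mult_strict_right_mono) auto
  also have "\<dots> \<le> crit * (2 * Q)"
    using E crit_bounds mult_left_mono[OF E, of crit] by (simp add: mult.assoc)
  also have "\<dots> \<le> 777 / 500 * (2 * Q)"
    using crit_bounds Qpos by (intro mult_right_mono) auto
  finally have "500 * v < 277 * Q" by simp
  then show False using vQ Qpos by linarith
qed

text \<open>After a meeting where \<open>q\<close> moves first, three cases remain: \<open>s\<close>
  reaches the next meeting in one step, \<open>q\<close> moves twice before \<open>s\<close> moves,
  or the two sequences interlace.\<close>

lemma no_second_meeting:
  assumes Q1: "q n = s m" "T \<le> q n" and less: "q (Suc n) < s (Suc m)"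
    and Q2: "q (n + k) = s (m + j)" "0 < k" "0 < j"
    and q_iso: "\<And>i. 0 < i \<Longrightarrow> i < k \<Longrightarrow> q (n + i) \<notin> range s"
    and s_iso: "\<And>i. 0 < i \<Longrightarrow> i < j \<Longrightarrow> s (m + i) \<notin> range q"
  shows False
proof -
  interpret S: approx_pair s eta b q xi a T by (rule swap)
  define x where "x i = q (n + i)" for i
  define y where "y i = s (m + i)" for i
  have x_less: "x i < x (Suc i)" and y_less: "y i < y (Suc i)" for i
    using A.q_less[of "n + i"] B.q_less[of "m + i"] by (simp_all add: x_def y_def)
  have x_mono: "i < i' \<Longrightarrow> x i < x i'" and y_mono: "i < i' \<Longrightarrow> y i < y i'" for i i'
    using A.q_strict_mono B.q_strict_mono by (simp_all add: x_def y_def strict_mono_less)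
  have x_mono': "i \<le> i' \<Longrightarrow> x i \<le> x i'" and y_mono': "i \<le> i' \<Longrightarrow> y i \<le> y i'" for i i'
    using A.q_strict_mono B.q_strict_mono by (simp_all add: x_def y_def strict_mono_less_eq)
  have x_pos: "0 < x i" and y_pos: "0 < y i" for i
    using A.q_pos B.q_pos by (simp_all add: x_def y_def)
  have x_ge: "x (Suc i) + x i \<le> x (Suc (Suc i))"
    and y_ge: "y (Suc i) + y i \<le> y (Suc (Suc i))" for i
    using A.q_rec_ge[of "n + i"] B.q_rec_ge[of "m + i"] by (simp_all add: x_def y_def)
  have x_rec: "x (Suc (Suc i)) = a (n + i) * x (Suc i) + x i"
    and y_rec: "y (Suc (Suc i)) = b (m + i) * y (Suc i) + y i" for i
    using A.q_rec[of "n + i"] B.q_rec[of "m + i"] by (simp_all add: x_def y_def)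
  have xy0: "x 0 = y 0" and T0: "T \<le> x 0" using Q1 by (simp_all add: x_def y_def)
  have xk: "x k = y j" using Q2 by (simp add: x_def y_def)
  have xy1: "x 1 < y 1" using less by (simp add: x_def y_def)
  have Tx: "T < x (Suc i)" and Ty: "T < y (Suc i)" for i
    using T0 xy0 x_mono[of 0 "Suc i"] y_mono[of 0 "Suc i"] by auto
  have incong': "\<not> x 0 dvd x 1 - y 1"
    using incong[OF Q1] by (simp add: x_def y_def)
  \<comment> \<open>The digit \<open>a (n + i)\<close> produces \<open>x (Suc (Suc i))\<close>; a
    digit 2 makes that denominator common, so it must be the end point \<open>x k\<close>.\<close>
  have adig: "a (n + i) = 1 \<or> a (n + i) = 2 \<and> Suc (Suc i) = k" if "Suc i < k" for i
  proof -
    have "x (Suc (Suc i)) \<notin> range s" if "Suc (Suc i) < k"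
      using q_iso[of "Suc (Suc i)"] that by (simp add: x_def)
    then show ?thesis
      using isolated_jump_digit[of "n + i"] q_iso[of "Suc i"] Tx[of i] that
      by (cases "Suc (Suc i) = k") (auto simp: x_def)
  qed
  have bdig: "b (m + i) = 1 \<or> b (m + i) = 2 \<and> Suc (Suc i) = j" if "Suc i < j" for i
  proof -
    have "y (Suc (Suc i)) \<notin> range q" if "Suc (Suc i) < j"
      using s_iso[of "Suc (Suc i)"] that by (simp add: y_def)
    then show ?thesis
      using S.isolated_jump_digit[of "m + i"] s_iso[of "Suc i"] Ty[of i] that
      by (cases "Suc (Suc i) = j") (auto simp: y_def)
  qed
  have start: "xi n < crit * eta m"
    using balance[of "q n" n m] Q1 A.q_less[of n] B.q_less[of m] by auto
  have x_start: "xi n * x 1 + xi (Suc n) * x 0 = 1"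
    and y_start: "eta m * y 1 + eta (Suc m) * y 0 = 1"
    using A.xi_q[of n] B.xi_q[of m] by (simp_all add: x_def y_def)
  have k2: "2 \<le> k"
  proof (rule ccontr)
    assume "\<not> 2 \<le> k"
    then have "k = 1" using Q2 by simp
    then show False using xk xy1 y_mono'[of 1 j] Q2 by auto
  qed
  have k_3: "k = 3 \<and> a (Suc n) = 1 \<and> (1 + sqrt 2) * xi (n + 3) < xi (n + 2)"
    if "2 < k" "x 2 < y 1"
  proof -
    note d = double_jump[of n m]
    have prem: "T \<le> q n" "s m \<le> q n" "q (Suc (Suc n)) < s (Suc m)"
      using that Q1 by (simp_all add: x_def y_def)
    have "q (n + 3) \<in> range s" using d(3)[OF prem] by (simp add: numeral_3_eq_3)
    with q_iso[of 3] that have "k = 3" by (cases "3 < k") auto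
    then show ?thesis using d(1,2)[OF prem] by (simp add: numeral_3_eq_3 numeral_2_eq_2)
  qed
  consider "j = 1" | "2 \<le> j" "2 < k" "x 2 < y 1" | "2 \<le> j" "2 < k \<Longrightarrow> y 1 < x 2"
  proof (cases "j = 1")
    case False
    then have j2: "2 \<le> j" using Q2 by simp
    have "x 2 \<noteq> y 1" if "2 < k"
      using s_iso[of 1] j2 rangeI[of q "n + 2"] by (metis x_def y_def less_one less_le_trans one_less_numeral_iff semiring_norm(76))
    then show ?thesis using that j2 by (cases "2 < k"; cases "x 2 < y 1") auto
  qed
  then show False
  proof cases
    case 1
    have y1: "y 1 = x k" using xk 1 by simp
    have "k = 2 \<or> k = 3"
      using k_3 k2 y1 x_mono[of 2 k] by (cases "k = 2") auto
    \<comment> \<open>Since \<open>y_start\<close> bounds \<open>eta m * y 1\<close> by 1, this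
      contradicts \<open>start\<close>.\<close>
    then have "crit \<le> xi n * y 1"
    proof
      assume k: "k = 2"
      have yx: "y 1 = a n * x 1 + x 0" using x_rec[of 0] y1 k by (simp add: numeral_2_eq_2)
      \<comment> \<open>Digit 1 would make the two successors of the common denominator differ by
        exactly \<open>x 0\<close>, which \<open>incong\<close> forbids.\<close>
      have "a n \<noteq> 1"
      proof
        assume "a n = 1"
        then have "x 1 - y 1 = - x 0" using yx by simp
        then show False using incong' by simp
      qed
      then have a2: "a n = 2" using adig[of 0] k by simp
      have "2 * xi (Suc n) \<le> xi n" using A.xi_rec[of n] A.xi_pos[of "Suc (Suc n)"] a2 by simp
      then have "2 * xi (Suc n) * x 0 \<le> xi n * x 0"
        using x_pos[of 0] by (intro mult_right_mono) auto
      then have "2 \<le> xi n * y 1" using x_start yx a2 by (simp add: algebra_simps)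
      then show ?thesis using crit_bounds by linarith
    next
      \<comment> \<open>Here \<open>xi n * y 1 \<ge> 7 / 4\<close>: one has
        \<open>xi n \<ge> 3 / 2 * xi (Suc n)\<close>, and
        \<open>xi (Suc n) * x 0 \<le> 1 / 2\<close> as the smaller summand in
        \<open>x_start\<close>.\<close>
      assume k: "k = 3"
      have yx: "2 * x 1 + x 0 \<le> y 1"
        using x_ge[of 0] x_ge[of 1] y1 k by (simp add: numeral_2_eq_2 numeral_3_eq_3)
      have "3 * xi (Suc n) \<le> 2 * xi n"
        using A.xi_rec_ge[of n] A.xi_less[of "Suc (Suc n)"] A.xi_rec[of "Suc n"]
          k_3 x_less[of 2] y1 k by simp
      then have 3: "3 * xi (Suc n) * x 0 \<le> 2 * xi n * x 0"
        using x_pos[of 0] by (intro mult_right_mono) auto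
      have "xi (Suc n) * x 0 \<le> xi n * x 1"
        using A.xi_less[of n] x_less[of 0] x_pos A.xi_pos by (intro mult_mono) (auto simp: less_imp_le)
      moreover have "xi n * (2 * x 1 + x 0) \<le> xi n * y 1"
        using yx A.xi_pos[of n] by (intro mult_left_mono) (auto simp flip: of_int_le_iff)
      ultimately show ?thesis using 3 x_start crit_bounds by (simp add: algebra_simps)
    qed
    also have "\<dots> < crit * eta m * y 1"
      using start y_pos[of 1] by (intro mult_strict_right_mono) auto
    also have "\<dots> \<le> crit * 1"
      unfolding mult.assoc
      using y_start B.xi_pos[of "Suc m"] y_pos[of 0] crit_bounds
      by (intro mult_left_mono) (auto intro!: less_imp_le dest: mult_pos_pos[of "eta (Suc m)" "y 0"])
    finally show False by simp
  next
    case 2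
    then have k: "k = 3" and a1: "a (Suc n) = 1"
      and big: "(1 + sqrt 2) * xi (n + 3) < xi (n + 2)" using k_3 by auto
    have a0: "a n = 1" using adig[of 0] k by auto
    have x2: "x 2 = x 1 + x 0" using x_rec[of 0] a0 by (simp add: numeral_2_eq_2)
    have x3: "x 3 = 2 * x 1 + x 0"
      using x_rec[of 1] a1 x2 by (simp add: numeral_2_eq_2 numeral_3_eq_3)
    \<comment> \<open>Already \<open>y 3 \<ge> 2 * y 1 + y 0\<close> exceeds
      \<open>x 3\<close>.\<close>
    have "j = 2"
    proof (rule ccontr)
      assume "j \<noteq> 2"
      then have "y 3 \<le> y j" using 2 by (intro y_mono') auto
      then show False
        using xk k x3 y_ge[of 0] y_ge[of 1] xy1 xy0 by (simp add: numeral_2_eq_2 numeral_3_eq_3)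
    qed
    then have eq: "b m * y 1 = 2 * x 1"
      using xk k x3 y_rec[of 0] xy0 by (simp add: numeral_2_eq_2)
    have b1: "b m = 1" using bdig[of 0] \<open>j = 2\<close> eq xy1 by auto
    then have y1: "y 1 = 2 * x 1" using eq by simp
    have e: "eta m \<le> 2 * eta (Suc m)"
      using B.xi_rec[of m] b1 B.xi_less[of "Suc m"] by simp
    have "eta m * x 0 \<le> 2 * eta (Suc m) * x 0"
      using e x_pos[of 0] by (intro mult_right_mono) auto
    then have e': "eta m * (4 * x 1 + x 0) \<le> 2" using y_start y1 xy0 by (simp add: algebra_simps)
    have r: "xi n = xi (n + 1) + xi (n + 2)" "xi (n + 1) = xi (n + 2) + xi (n + 3)"
      using A.xi_rec[of n] A.xi_rec[of "Suc n"] a0 a1 by (simp_all add: numeral_2_eq_2 numeral_3_eq_3)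
    \<comment> \<open>This yields \<open>xi (n + 3) \<le> 5 / 12 * xi (n + 2)\<close>, so
      \<open>xi (n + 1) / xi n\<close> is at most 17/29, below 59/100.\<close>
    have "7 / 5 \<le> sqrt 2" by (rule real_le_rsqrt) (simp add: power2_eq_square)
    then have "12 / 5 * xi (n + 3) \<le> (1 + sqrt 2) * xi (n + 3)"
      using A.xi_pos[of "n + 3"] by (intro mult_right_mono) auto
    then have "12 * xi (n + 3) \<le> 5 * xi (n + 2)" using big by simp
    then have "100 * xi (n + 1) \<le> 59 * xi n" using r A.xi_pos[of "n + 3"] by simp
    then have "xi (n + 1) \<le> 59 / 100 * xi n" by simp
    then have "xi (n + 1) * x 0 \<le> 59 / 100 * xi n * x 0" using x_pos[of 0] by (intro mult_right_mono) auto
    then have X: "1 \<le> xi n * (x 1 + 59 / 100 * x 0)" using x_start by (simp add: algebra_simps)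
    have pos: "0 < x 1 + 59 / 100 * x 0" using x_pos[of 0] x_pos[of 1] by (simp add: add_pos_pos)
    have "1 \<le> xi n * (x 1 + 59 / 100 * x 0)" by (rule X)
    also have "\<dots> < crit * eta m * (x 1 + 59 / 100 * x 0)"
      using start pos by (intro mult_strict_right_mono) auto
    also have "\<dots> \<le> 777 / 500 * eta m * (x 1 + 59 / 100 * x 0)"
      using crit_bounds B.xi_pos[of m] pos by (intro mult_right_mono) auto
    also have "\<dots> = eta m * (777 / 500 * x 1 + 45843 / 50000 * x 0)" by (simp add: algebra_simps)
    \<comment> \<open>The excess at \<open>x 0\<close> is absorbed by the slack at
      \<open>x 1\<close>, because \<open>x 0 < x 1\<close> and 1.554 + 0.917 < 2.5.\<close>
    also have "\<dots> \<le> eta m * (2 * real_of_int (x 1) + 1 / 2 * real_of_int (x 0))"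
    proof (intro mult_left_mono)
      have "real_of_int (x 0) \<le> x 1" using x_less[of 0] by simp
      then show "777 / 500 * real_of_int (x 1) + 45843 / 50000 * real_of_int (x 0)
          \<le> 2 * real_of_int (x 1) + 1 / 2 * real_of_int (x 0)" 
        using x_pos[of 0] by simp
    qed (use B.xi_pos[of m] in auto)
    also have "\<dots> \<le> 1" using e' by (simp add: algebra_simps)
    finally show False by simp
  next
    case 3
    \<comment> \<open>Both sequences obey the Fibonacci recursion until the last step, which preserves the
      interlacing \<open>x i \<le> y i < x (i + 1)\<close>.\<close>
    have xrec1: "x (Suc (Suc i)) = x (Suc i) + x i" if "Suc (Suc i) < k" for i
      using x_rec[of i] adig[of i] that by auto
    have yrec1: "y (Suc (Suc i)) = y (Suc i) + y i" if "Suc (Suc i) < j" for i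
      using y_rec[of i] bdig[of i] that by auto
    have xy: "(i < k \<longrightarrow> i < j \<longrightarrow> x i \<le> y i \<and> (0 < i \<longrightarrow> x i < y i)) \<and>
        (Suc i < k \<longrightarrow> Suc i < j \<longrightarrow> x (Suc i) < y (Suc i))" for i
    proof (induction i)
      case (Suc i)
      then show ?case using xrec1[of i] yrec1[of i] by auto
    qed (use xy0 xy1 in auto)
    have yx: "(Suc i < k \<longrightarrow> i < j \<longrightarrow> y i < x (Suc i)) \<and>
        (Suc (Suc i) < k \<longrightarrow> Suc i < j \<longrightarrow> y (Suc i) < x (Suc (Suc i)))" for i
    proof (induction i)
      case 0
      then show ?case using xy0 x_less[of 0] 3 by (auto simp: numeral_2_eq_2)
    next
      case (Suc i)
      then show ?case using xrec1[of "Suc i"] yrec1[of i] by auto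
    qed
    consider "k < j" | "j = k" | "k = Suc j" | "Suc j < k" by linarith
    then show False
    proof cases
      case 1
      obtain i where i: "k = Suc (Suc i)" using k2 by (metis add_2_eq_Suc le_Suc_ex)
      \<comment> \<open>Even with final digit 2, \<open>x k\<close> stays below
        \<open>y (Suc k)\<close>; the case \<open>Suc j < k\<close> is analogous.\<close>
      have "x k \<le> 2 * x (Suc i) + x i"
        using x_rec[of i] adig[of i] i x_pos[of "Suc i"] by auto
      also have "\<dots> < 2 * y (Suc i) + y i"
        using xy[of i] xy[of "Suc i"] 1 i by auto
      also have "\<dots> \<le> y (Suc k)" using y_ge[of i] y_ge[of "Suc i"] i by simp
      also have "\<dots> \<le> y j" using 1 by (intro y_mono') simp
      finally show ?thesis using xk by simp
    next
      case 2
      obtain i where i: "k = Suc (Suc i)" using k2 by (metis add_2_eq_Suc le_Suc_ex)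
      have lt: "x i \<le> y i" "x (Suc i) < y (Suc i)" "y i < x (Suc i)"
        using xy[of i] xy[of "Suc i"] yx[of i] 2 i by auto
      \<comment> \<open>The \<open>x\<close> terms are the smaller ones, so a meeting needs the
        larger digit on their side.\<close>
      have a2: "a (n + i) = 2" and b1: "b (m + i) = 1"
        using adig[of i] bdig[of i] lt xk x_rec[of i] y_rec[of i] y_pos[of "Suc i"] 2 i by auto
      have eq: "2 * x (Suc i) + x i = y (Suc i) + y i"
        using xk x_rec[of i] y_rec[of i] a2 b1 2 i by simp
      have "14 * y i \<le> 11 * y (Suc i)"
      proof -
        consider "i = 0" | "i = 1" | l where "i = Suc (Suc l)"
          by (metis One_nat_def not0_implies_Suc)
        then show ?thesis
        proof cases
          case 1
          then show ?thesis using eq xy0 x_less[of 0] x_pos[of 0] by simp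
        next
          \<comment> \<open>Contradictory: \<open>eq\<close> becomes
            \<open>2 * y 1 = 3 * x 1 + x 0\<close>, against \<open>y 1 < x 1 + x 0\<close> and
            \<open>x 0 < x 1\<close>.\<close>
          case 2
          then have "x 2 = x 1 + x 0" "y 2 = y 1 + y 0"
            using xrec1[of 0] yrec1[of 0] i \<open>j = k\<close> by (auto simp: numeral_2_eq_2)
          then show ?thesis
            using eq xy0 x_less[of 0] lt 2 by (simp add: numeral_2_eq_2)
        next
          \<comment> \<open>Two Fibonacci steps from \<open>y l < y (Suc l)\<close> bring the ratio
            below 2/3.\<close>
          case (3 l)
          then show ?thesis
            using yrec1[of l] yrec1[of "Suc l"] y_less[of l] y_pos[of "Suc l"] i \<open>j = k\<close> by auto
        qed
      qed
      \<comment> \<open>At time \<open>y i\<close> both sequences are in their last gap but one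
        before the meeting.\<close>
      then show ?thesis
        using no_meeting_two_one[of "n + i" "m + i" "y i"] lt a2 b1 xk i 2 T0 xy0 y_less[of i]
          y_mono'[of 0 i] by (simp add: x_def y_def)
    next
      case 3
      obtain i where i: "j = Suc (Suc i)" using \<open>2 \<le> j\<close> by (metis add_2_eq_Suc le_Suc_ex)
      have lt: "y i < x (Suc i)" "y (Suc i) < x (Suc (Suc i))" "x (Suc i) < y (Suc i)"
        using xy[of "Suc i"] yx[of i] yx[of "Suc i"] 3 i by auto
      \<comment> \<open>Against the shifted \<open>x\<close>, the \<open>y\<close> terms are the
        smaller ones, so the digits 2 and 1 change sides.\<close>
      have b2: "b (m + i) = 2" and a1: "a (n + Suc i) = 1"
        using adig[of "Suc i"] bdig[of i] lt xk x_rec[of "Suc i"] y_rec[of i]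
          x_pos[of "Suc (Suc i)"] 3 i by auto
      have eq: "2 * y (Suc i) + y i = x (Suc (Suc i)) + x (Suc i)"
        using xk x_rec[of "Suc i"] y_rec[of i] a1 b2 3 i by simp
      have "14 * x (Suc i) \<le> 11 * x (Suc (Suc i))"
      proof (cases i)
        \<comment> \<open>Contradictory: \<open>eq\<close> gives \<open>y 1 = x 1\<close>, against
          \<open>xy1\<close>.\<close>
        case 0
        then have "x 2 = x 1 + x 0" using xrec1[of 0] 3 i by (simp add: numeral_2_eq_2)
        then show ?thesis using eq xy0 xy1 0 by (simp add: numeral_2_eq_2)
      next
        case (Suc l)
        then show ?thesis
          using xrec1[of l] xrec1[of "Suc l"] x_less[of l] x_pos[of "Suc l"] 3 i by auto
      qed
      then show ?thesis
        using S.no_meeting_two_one[of "m + i" "n + Suc i" "x (Suc i)"] lt a1 b2 xk i 3 Tx[of i]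
          x_less[of "Suc i"] by (simp add: x_def y_def)
    next
      case 4
      obtain i where i: "j = Suc (Suc i)" using \<open>2 \<le> j\<close> by (metis add_2_eq_Suc le_Suc_ex)
      have "y j \<le> 2 * y (Suc i) + y i"
        using y_rec[of i] bdig[of i] i y_pos[of "Suc i"] by auto
      also have "\<dots> < 2 * x (Suc (Suc i)) + x (Suc i)"
        using yx[of i] yx[of "Suc i"] 4 i by auto
      also have "\<dots> \<le> x (Suc (Suc j))" using x_ge[of "Suc i"] x_ge[of "Suc (Suc i)"] i by simp
      also have "\<dots> \<le> x k" using 4 by (intro x_mono') simp
      finally show ?thesis using xk by simp
    qed
  qed
qed

text \<open>The least admissible \<open>k\<close> yields consecutive meetings, and
  \<open>no_second_meeting\<close> applies to the sequence that moves first; equal successors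
  contradict \<open>incong\<close>, since everything divides 0.\<close>

lemma no_two_meetings:
  assumes "q n \<in> range s" "q n' \<in> range s" "n < n'" "T \<le> q n"
  shows False
proof -
  interpret S: approx_pair s eta b q xi a T by (rule swap)
  obtain m where m: "q n = s m" using assms(1) by auto
  define k where "k = (LEAST k. 0 < k \<and> q (n + k) \<in> range s)"
  have "\<exists>k. 0 < k \<and> q (n + k) \<in> range s"
    using assms(2,3) by (intro exI[of _ "n' - n"]) auto
  then have k: "0 < k" "q (n + k) \<in> range s"
    unfolding k_def by (metis (mono_tags, lifting) LeastI_ex)+
  have q_iso: "q (n + i) \<notin> range s" if "0 < i" "i < k" for i
    using not_less_Least[of i "\<lambda>k. 0 < k \<and> q (n + k) \<in> range s"] that by (auto simp: k_def)
  obtain m' where m': "q (n + k) = s m'" using k(2) by auto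
  have "q n < q (n + k)" using A.q_strict_mono k(1) by (simp add: strict_mono_less)
  then have "m < m'" using m m' B.q_strict_mono by (metis strict_mono_less)
  define j where "j = m' - m"
  have j: "0 < j" "q (n + k) = s (m + j)" using \<open>m < m'\<close> m' by (simp_all add: j_def)
  have s_iso: "s (m + i) \<notin> range q" if i: "0 < i" "i < j" for i
  proof
    assume "s (m + i) \<in> range q"
    then obtain l where l: "s (m + i) = q l" by auto
    have "q n < q l" "q l < q (n + k)"
      using i l[symmetric] m j B.q_strict_mono by (simp_all add: strict_mono_less)
    then have "n < l" "l < n + k"
      using A.q_strict_mono by (simp_all add: strict_mono_less)
    then show False using q_iso[of "l - n"] l by (metis add_diff_inverse_nat add_less_cancel_left
      less_imp_not_less rangeI zero_less_diff)
  qed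
  consider "q (Suc n) = s (Suc m)" | "q (Suc n) < s (Suc m)" | "s (Suc m) < q (Suc n)"
    by linarith
  then show False
  proof cases
    case 1
    then show ?thesis using incong[OF m assms(4)] by simp
  next
    case 2
    then show ?thesis using no_second_meeting[OF m assms(4) 2 j(2) k(1) j(1)] q_iso s_iso by blast
  next
    case 3
    then show ?thesis
      using S.no_second_meeting[OF m[symmetric] _ 3 j(2)[symmetric] j(1) k(1)] q_iso s_iso m assms(4)
      by simp
  qed
qed

text \<open>Beyond the last common denominator every jump is isolated, and a digit 2 would announce
  another common one.\<close>

lemma eventually_ones: "\<exists>N. \<forall>n\<ge>N. a n = 1"
proof -
  have T: "T < q n" if "nat T + 1 \<le> n" for n
    using A.q_ge[of n] A.q_pos[of 0] that by linarith
  have "\<exists>M. \<forall>n\<ge>M. T < q n \<and> q n \<notin> range s"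
  proof (cases "\<exists>n. T \<le> q n \<and> q n \<in> range s")
    case True
    then obtain n where "T \<le> q n" "q n \<in> range s" by auto
    then show ?thesis
      using no_two_meetings T
      by (intro exI[of _ "max (Suc n) (nat T + 1)"]) (meson Suc_le_lessD max.boundedE)
  next
    case False
    then show ?thesis using T by (intro exI[of _ "nat T + 1"]) (meson less_imp_le)
  qed
  then obtain M where "\<And>n. n \<ge> M \<Longrightarrow> T < q n \<and> q n \<notin> range s" by auto
  then have "a n = 1" if "n \<ge> M" for n
    using isolated_jump_digit[of n] that by (meson le_Suc_eq)
  then show ?thesis by blast
qed

end

section \<open>Convergents\<close>

fun cf_den :: "real \<Rightarrow> nat \<Rightarrow> int" where
  "cf_den x 0 = 1"
| "cf_den x (Suc 0) = cf_digit x 1"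
| "cf_den x (Suc (Suc n)) = cf_digit x (Suc (Suc n)) * cf_den x (Suc n) + cf_den x n"

fun cf_num :: "real \<Rightarrow> nat \<Rightarrow> int" where
  "cf_num x 0 = cf_digit x 0"
| "cf_num x (Suc 0) = cf_digit x 1 * cf_digit x 0 + 1"
| "cf_num x (Suc (Suc n)) = cf_digit x (Suc (Suc n)) * cf_num x (Suc n) + cf_num x n"

text \<open>The reciprocal of the product of the remainders with indices 1 to \<open>n + 1\<close>,
  which is the distance from \<open>cf_den x n * x\<close> to \<open>cf_num x n\<close>;
  \<open>cf_err_signed\<close> adds the sign.\<close>

primrec cf_err :: "real \<Rightarrow> nat \<Rightarrow> real" where
  "cf_err x 0 = 1 / cf_remainder x 1"
| "cf_err x (Suc n) = cf_err x n / cf_remainder x (Suc (Suc n))"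

declare cf_remainder.simps(2) [simp del]

lemma cf_det: "cf_den x n * cf_num x (Suc n) - cf_den x (Suc n) * cf_num x n = (-1) ^ n"
  by (induction n) (simp_all add: algebra_simps)

context
  fixes x :: real
  assumes irr: "x \<notin> \<rat>"
begin

lemma cf_remainder_irrational: "cf_remainder x n \<notin> \<rat>"
proof (induction n)
  case (Suc n)
  show ?case
  proof
    assume "cf_remainder x (Suc n) \<in> \<rat>"
    then have "1 / cf_remainder x (Suc n) \<in> \<rat>" by (intro Rats_divide) auto
    then have "frac (cf_remainder x n) + of_int \<lfloor>cf_remainder x n\<rfloor> \<in> \<rat>"
      by (intro Rats_add) (auto simp: cf_remainder.simps(2))
    then show False using Suc by (simp add: frac_def)
  qed
qed (simp add: irr)

lemma cf_remainder_gt_1: "1 < cf_remainder x (Suc n)"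
proof -
  have "frac (cf_remainder x n) \<noteq> 0"
    using cf_remainder_irrational[of n] Ints_subset_Rats by (auto simp: frac_eq_0_iff)
  then have "0 < frac (cf_remainder x n)" using frac_ge_0[of "cf_remainder x n"] by linarith
  then show ?thesis using frac_lt_1[of "cf_remainder x n"] by (simp add: cf_remainder.simps(2))
qed

lemma cf_remainder_eq: "cf_remainder x n = of_int (cf_digit x n) + 1 / cf_remainder x (Suc n)"
  by (simp add: cf_digit_def frac_def cf_remainder.simps(2))

lemma cf_digit_pos: "1 \<le> cf_digit x (Suc n)"
  using cf_remainder_gt_1[of n] unfolding cf_digit_def by (simp add: le_floor_iff)

lemma cf_den_pos: "0 < cf_den x n"
\<comment> \<open>The induction rule varies the first argument too, so the predicate ties it to the
  fixed irrational \<open>x\<close>.\<close>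
proof (induction x n rule: cf_den.induct[where P = "\<lambda>y n. y = x \<longrightarrow> 0 < cf_den y n", THEN mp])
  case (2 y)
  show ?case using cf_digit_pos[of 0] by auto
next
  case (3 y n)
  then show ?case using cf_digit_pos[of "Suc n"] by (auto intro!: add_pos_pos mult_pos_pos)
qed auto

lemma cf_den_less: "cf_den x (Suc n) < cf_den x (Suc (Suc n))"
  using mult_right_mono[OF cf_digit_pos[of "Suc n"], of "cf_den x (Suc n)"]
    cf_den_pos[of n] cf_den_pos[of "Suc n"] unfolding cf_den.simps(3) by linarith

lemma cf_err_pos: "0 < cf_err x n"
proof (induction n)
  case 0
  then show ?case using cf_remainder_gt_1[of 0] by simp
next
  case (Suc n)
  then show ?case using cf_remainder_gt_1[of "Suc n"] by (simp)
qed

lemma cf_err_less: "cf_err x (Suc n) < cf_err x n"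
  using cf_remainder_gt_1[of "Suc n"] cf_err_pos[of n]
  by (simp add: field_simps)

lemma cf_err_rec:
  "cf_err x n = of_int (cf_digit x (Suc (Suc n))) * cf_err x (Suc n) + cf_err x (Suc (Suc n))"
proof -
  define r where "r = cf_remainder x (Suc (Suc n))"
  define r' where "r' = cf_remainder x (Suc (Suc (Suc n)))"
  have pos: "0 < r" "0 < r'"
    using cf_remainder_gt_1[of "Suc n"] cf_remainder_gt_1[of "Suc (Suc n)"]
    by (simp_all add: r_def r'_def)
  have "r = of_int (cf_digit x (Suc (Suc n))) + 1 / r'"
    unfolding r_def r'_def by (rule cf_remainder_eq)
  moreover have "cf_err x n = r * cf_err x (Suc n)" "cf_err x (Suc (Suc n)) = cf_err x (Suc n) / r'"
    using pos by (simp_all add: r_def r'_def)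
  ultimately show ?thesis by (simp add: distrib_right del: cf_err.simps)
qed

lemma cf_err_less_1: "cf_err x n < 1"
proof (induction n)
  case 0
  then show ?case using cf_remainder_gt_1[of 0] by simp
next
  case (Suc n)
  then show ?case using cf_err_less[of n] by linarith
qed

lemma cf_err_signed: "of_int (cf_den x n) * x - of_int (cf_num x n) = (-1) ^ n * cf_err x n"
proof -
  have "of_int (cf_den x n) * x - of_int (cf_num x n) = (-1) ^ n * cf_err x n \<and>
    of_int (cf_den x (Suc n)) * x - of_int (cf_num x (Suc n)) = (-1) ^ Suc n * cf_err x (Suc n)"
  proof (induction n)
    case 0
    define r s where "r = cf_remainder x (Suc 0)" and "s = cf_remainder x (Suc (Suc 0))"
    have pos: "0 < r" "0 < s"
      using cf_remainder_gt_1[of 0] cf_remainder_gt_1[of 1]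
      by (simp_all add: r_def s_def)
    have 1: "x = of_int (cf_digit x 0) + 1 / r" "r = of_int (cf_digit x 1) + 1 / s"
      using cf_remainder_eq[of 0] cf_remainder_eq[of 1]
      by (simp_all add: r_def s_def)
    have "cf_err x 0 = 1 / r" "cf_err x (Suc 0) = 1 / r / s"
      by (simp_all add: r_def s_def)
    moreover have "of_int (cf_digit x 1) * x - of_int (cf_digit x 1 * cf_digit x 0 + 1) = - (1 / r / s)"
    proof -
      have "of_int (cf_digit x 1) * x - of_int (cf_digit x 1 * cf_digit x 0 + 1)
          = of_int (cf_digit x 1) * (1 / r) - 1"
        by (subst (2) 1(1)) (simp add: algebra_simps)
      also have "\<dots> = (r - 1 / s) * (1 / r) - 1" using 1(2) by simp
      also have "\<dots> = - (1 / r / s)" using pos by (simp add: field_simps)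
      finally show ?thesis .
    qed
    moreover have "x - of_int (cf_digit x 0) = 1 / r" using 1(1) by linarith
    ultimately show ?case by auto
  next
    case (Suc n)
    have "of_int (cf_den x (Suc (Suc n))) * x - of_int (cf_num x (Suc (Suc n)))
      = of_int (cf_digit x (Suc (Suc n))) *
          (of_int (cf_den x (Suc n)) * x - of_int (cf_num x (Suc n)))
        + (of_int (cf_den x n) * x - of_int (cf_num x n))"
      by (simp add: algebra_simps)
    also have "\<dots> = of_int (cf_digit x (Suc (Suc n))) * ((-1) ^ Suc n * cf_err x (Suc n)) + (-1) ^ n * cf_err x n"
      using Suc by (simp only:)
    also have "\<dots> = (-1) ^ Suc (Suc n) * cf_err x (Suc (Suc n))"
      by (subst cf_err_rec[of n]) (simp add: algebra_simps del: cf_err.simps)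
    finally show ?case using Suc by blast
  qed
  then show ?thesis ..
qed

text \<open>Eliminating \<open>x\<close> from two neighbouring signed errors leaves the determinant
  \<open>cf_det\<close>; their opposite signs turn the difference into a sum.\<close>

lemma cf_err_den:
  "cf_err x n * of_int (cf_den x (Suc n)) + cf_err x (Suc n) * of_int (cf_den x n) = 1"
proof -
  have "real_of_int ((-1) ^ n) = of_int (cf_den x n * cf_num x (Suc n) - cf_den x (Suc n) * cf_num x n)"
    by (simp only: cf_det)
  also have "\<dots> = of_int (cf_den x (Suc n)) * (of_int (cf_den x n) * x - of_int (cf_num x n))
      - of_int (cf_den x n) * (of_int (cf_den x (Suc n)) * x - of_int (cf_num x (Suc n)))"
    by (simp add: algebra_simps)
  also have "\<dots> = (-1) ^ n *
      (cf_err x n * of_int (cf_den x (Suc n)) + cf_err x (Suc n) * of_int (cf_den x n))"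
    by (simp only: cf_err_signed) (simp add: algebra_simps del: cf_err.simps)
  finally show ?thesis by simp
qed

text \<open>The shift by one is needed because the denominators \<open>q\<^sub>0\<close> and \<open>q\<^sub>1\<close> coincide if \<open>a\<^sub>1 = 1\<close>.\<close>

lemma approx_seq_cf:
  "approx_seq (\<lambda>n. cf_den x (Suc n)) (\<lambda>n. cf_err x (Suc n)) (\<lambda>n. cf_digit x (n + 3))"
  by unfold_locales
    (simp_all add: cf_den_pos cf_den_less cf_digit_pos cf_err_pos cf_err_less cf_err_den
      cf_err_rec[symmetric] eval_nat_numeral del: cf_err.simps cf_den.simps(2) cf_den.simps(3), simp_all)

section \<open>Best approximation and the measure function\<close>

text \<open>Lagrange's argument: in the basis of two neighbouring convergents, \<open>(q, p)\<close>
  has coordinates \<open>u \<noteq> 0\<close> and \<open>v\<close> that are not of the same sign,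
  while the errors of the convergents alternate, so the two contributions add up.\<close>

lemma cf_err_best:
  assumes "1 \<le> q" "q < cf_den x (Suc n)"
  shows "cf_err x n \<le> \<bar>of_int q * x - of_int p\<bar>"
proof -
  define d where "d = (-1 :: int) ^ n"
  \<comment> \<open>Cramer's rule, with determinant \<open>d\<close> equal to 1 or -1.\<close>
  define u where "u = d * (q * cf_num x (Suc n) - cf_den x (Suc n) * p)"
  define v where "v = d * (cf_den x n * p - q * cf_num x n)"
  have dd: "d * d = 1" by (simp add: d_def flip: power_mult_distrib)
  have det: "cf_den x n * cf_num x (Suc n) - cf_den x (Suc n) * cf_num x n = d"
    by (simp add: cf_det d_def del: cf_num.simps cf_den.simps)
  have "u * cf_den x n + v * cf_den x (Suc n)
      = d * q * (cf_den x n * cf_num x (Suc n) - cf_den x (Suc n) * cf_num x n)"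
    by (simp add: u_def v_def algebra_simps)
  also have "\<dots> = d * d * q" by (simp add: det)
  finally have q: "q = u * cf_den x n + v * cf_den x (Suc n)"
    by (simp add: dd)
  have "u * cf_num x n + v * cf_num x (Suc n)
      = d * p * (cf_den x n * cf_num x (Suc n) - cf_den x (Suc n) * cf_num x n)"
    by (simp add: u_def v_def algebra_simps)
  also have "\<dots> = d * d * p" by (simp add: det)
  finally have p: "p = u * cf_num x n + v * cf_num x (Suc n)"
    by (simp add: dd)
  have "of_int q * x - of_int p = of_int u * (of_int (cf_den x n) * x - of_int (cf_num x n))
      + of_int v * (of_int (cf_den x (Suc n)) * x - of_int (cf_num x (Suc n)))"
    by (subst q, subst p) (simp add: algebra_simps)
  also have "\<dots> = (-1) ^ n * (of_int u * cf_err x n - of_int v * cf_err x (Suc n))"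
    by (simp only: cf_err_signed) (simp add: algebra_simps del: cf_err.simps)
  finally have eq: "\<bar>of_int q * x - of_int p\<bar> = \<bar>of_int u * cf_err x n - of_int v * cf_err x (Suc n)\<bar>"
    by (simp add: abs_mult power_abs)
  have u0: "u \<noteq> 0"
  proof
    assume "u = 0"
    then have "q = v * cf_den x (Suc n)" using q by simp
    then show False
      using assms cf_den_pos[of "Suc n"] by (metis zdvd_not_zless dvd_triv_right zero_less_one less_le_trans)
  qed
  have uv: "u < 0 \<and> 0 \<le> v \<or> 0 < u \<and> v \<le> 0"
  proof (rule ccontr)
    assume "\<not> ?thesis"
    then consider "u < 0" "v < 0" | "0 < u" "0 < v" using u0 by linarith
    then show False
    proof cases
      case 1
      then have "u * cf_den x n < 0" "v * cf_den x (Suc n) < 0"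
        using cf_den_pos by (auto intro: mult_neg_pos)
      then show False using q assms by linarith
    next
      case 2
      then have "0 < u * cf_den x n" "1 * cf_den x (Suc n) \<le> v * cf_den x (Suc n)"
        using cf_den_pos[of n] cf_den_pos[of "Suc n"] by (auto intro!: mult_right_mono)
      then show False using q assms by linarith
    qed
  qed
  then have "1 * cf_err x n \<le> \<bar>of_int u * cf_err x n - of_int v * cf_err x (Suc n)\<bar>"
  proof (elim disjE conjE)
    assume "u < 0" "0 \<le> v"
    then have "1 * cf_err x n \<le> - of_int u * cf_err x n" "0 \<le> of_int v * cf_err x (Suc n)"
      using cf_err_pos[of n] cf_err_pos[of "Suc n"]
      by (intro mult_right_mono mult_nonneg_nonneg; simp del: cf_err.simps)+
    then show ?thesis by linarith
  next
    assume "0 < u" "v \<le> 0"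
    then have "1 * cf_err x n \<le> of_int u * cf_err x n" "0 \<le> - of_int v * cf_err x (Suc n)"
      using cf_err_pos[of n] cf_err_pos[of "Suc n"]
      by (intro mult_right_mono mult_nonneg_nonneg; simp del: cf_err.simps)+
    then show ?thesis by linarith
  qed
  then show ?thesis by (simp add: eq del: cf_err.simps)
qed

lemma irr_measure_eq:
  assumes "cf_den x n \<le> t" "t < cf_den x (Suc n)"
  shows "irr_measure x (of_int t) = cf_err x n"
  unfolding irr_measure_def
proof (rule Min_eqI)
  have "{q::int. 1 \<le> q \<and> real_of_int q \<le> real_of_int t} = {1..t}" by auto
  then show "finite ((\<lambda>q. dist_int (of_int q * x)) ` {q::int. 1 \<le> q \<and> real_of_int q \<le> real_of_int t})"
    by simp
next
  fix y assume "y \<in> (\<lambda>q. dist_int (of_int q * x)) ` {q::int. 1 \<le> q \<and> real_of_int q \<le> real_of_int t}"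
  then show "cf_err x n \<le> y" using cf_err_best assms by (auto simp: dist_int_def)
next
  have "\<bar>of_int (cf_den x n) * x - of_int (cf_num x n)\<bar> = cf_err x n"
    using cf_err_pos[of n] by (simp add: cf_err_signed abs_mult power_abs)
  then have "dist_int (of_int (cf_den x n) * x) = cf_err x n"
    using cf_err_best[of "cf_den x n" n] assms cf_den_pos[of n]
      round_diff_minimal[of "of_int (cf_den x n) * x" "cf_num x n"]
    by (intro antisym) (auto simp: dist_int_def)
  then show "cf_err x n \<in> (\<lambda>q. dist_int (of_int q * x)) ` {q::int. 1 \<le> q \<and> real_of_int q \<le> real_of_int t}"
    using assms cf_den_pos[of n] by (intro image_eqI[of _ _ "cf_den x n"]) auto
qed

end

text \<open>
  Consecutive denominators determine the numerator modulo \<open>cf_den x n\<close> up to sign, so a common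
  denominator with congruent successors makes \<open>x\<close> or \<open>-x\<close> close to \<open>y\<close> modulo \<open>1\<close>.
\<close>

lemma cf_den_congruent:
  assumes "x \<notin> \<rat>" "y \<notin> \<rat>" and eq: "cf_den x n = cf_den y m"
    and dvd: "cf_den x n dvd cf_den x (Suc n) - cf_den y (Suc m)"
  shows "dist_int (x - y) \<le> 2 / of_int (cf_den x n) \<or> dist_int (x + y) \<le> 2 / of_int (cf_den x n)"
proof -
  define Q where "Q = cf_den x n"
  have Qpos: "0 < Q" using cf_den_pos[OF assms(1)] by (simp add: Q_def)
  define p where "p = cf_num x n"
  define r where "r = cf_num y m"
  \<comment> \<open>The parities of \<open>n\<close> and \<open>m\<close> decide whether
    \<open>p\<close> is congruent to \<open>r\<close> or to \<open>-r\<close> modulo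
    \<open>Q\<close>, hence whether \<open>x - y\<close> or \<open>x + y\<close> is near an
    integer.\<close>
  define c where "c = (-1 :: int) ^ n * (-1) ^ m"
  have c: "c = 1 \<or> c = -1" unfolding c_def by (cases "even n"; cases "even m") auto
  have dx: "Q * cf_num x (Suc n) - cf_den x (Suc n) * p = (-1) ^ n"
    and dy: "Q * cf_num y (Suc m) - cf_den y (Suc m) * r = (-1) ^ m"
    using cf_det[of x n] cf_det[of y m] eq by (simp_all add: Q_def p_def r_def)
  have "c * (-1) ^ m = (-1 :: int) ^ n"
    unfolding c_def by (cases "even m") auto
  then have "cf_den x (Suc n) * (p - c * r)
     = Q * (cf_num x (Suc n) - c * cf_num y (Suc m)) - c * r * (cf_den x (Suc n) - cf_den y (Suc m))"
    using arg_cong[OF dy, of "\<lambda>z. c * z"] dx by (simp add: algebra_simps)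
  then have "Q dvd cf_den x (Suc n) * (p - c * r)" using dvd by (simp add: Q_def)
  moreover have "coprime Q (cf_den x (Suc n))"
  proof (rule coprimeI)
    fix e assume "e dvd Q" "e dvd cf_den x (Suc n)"
    then have "e dvd (-1) ^ n" by (metis dx dvd_diff dvd_mult2)
    then show "is_unit e" by (cases "even n") auto
  qed
  ultimately have "Q dvd p - c * r" by (simp add: coprime_dvd_mult_right_iff)
  then obtain z where z: "p - c * r = Q * z" by (auto elim: dvdE)
  have ex: "\<bar>of_int Q * x - of_int p\<bar> \<le> 1" and ey: "\<bar>of_int Q * y - of_int r\<bar> \<le> 1"
    using cf_err_signed[OF assms(1), of n] cf_err_pos[OF assms(1), of n] cf_err_less_1[OF assms(1), of n]
      cf_err_signed[OF assms(2), of m] cf_err_pos[OF assms(2), of m] cf_err_less_1[OF assms(2), of m] eq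
    by (simp_all add: Q_def p_def r_def abs_mult power_abs)
  have zr: "real_of_int p - of_int c * of_int r = of_int Q * of_int z"
    using z by (metis of_int_diff of_int_mult)
  have "dist_int (x - of_int c * y) \<le> \<bar>x - of_int c * y - of_int z\<bar>"
    unfolding dist_int_def by (rule round_diff_minimal)
  also have "\<dots> = \<bar>of_int Q * (x - of_int c * y - of_int z)\<bar> / of_int Q"
    using Qpos by (simp add: abs_mult)
  also have "of_int Q * (x - of_int c * y - of_int z)
      = (of_int Q * x - of_int p) - of_int c * (of_int Q * y - of_int r)"
    using zr by (simp add: algebra_simps)
  also have "\<bar>\<dots>\<bar> / of_int Q \<le> 2 / of_int Q"
    using ex ey c Qpos by (intro divide_right_mono) auto
  finally show ?thesis using c by (auto simp: Q_def)
qed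

section \<open>The golden ratio and the final contradiction\<close>

lemma dist_int_pos: "z \<notin> \<int> \<Longrightarrow> 0 < dist_int z"
  by (metis Ints_of_int dist_int_def eq_iff_diff_eq_0 zero_less_abs_iff)

lemma golden_remainder: "cf_remainder golden n = golden" and floor_golden: "\<lfloor>golden\<rfloor> = 1"
proof -
  have s: "1 < sqrt 5" "sqrt 5 < 3" by (auto intro: real_less_lsqrt)
  then show f: "\<lfloor>golden\<rfloor> = 1" by (simp add: golden_def floor_eq_iff)
  have "1 / frac golden = golden"
    using s by (simp add: frac_def f) (simp add: golden_def field_simps)
  then show "cf_remainder golden n = golden" by (induction n) (auto simp: cf_remainder.simps(2))
qed

text \<open>\<open>golden\<close> is fixed by the continued fraction step, so all its digits are 1;
  \<open>cf_tail\<close> depends on the digits alone, so equal digit sequences give equal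
  tails.\<close>

lemma cf_equivalent_golden:
  assumes "\<And>n. N \<le> n \<Longrightarrow> cf_digit x (n + 3) = 1"
  shows "cf_equivalent x golden"
proof -
  have "cf_digit x (N + 3 + i) = 1" for i
    using assms[of "N + i"] by (metis add.assoc add.commute le_add1)
  then have "cf_tail x (N + 3) = cf_tail golden 0"
    by (simp add: cf_tail_def cf_digit_def golden_remainder floor_golden)
  then show ?thesis unfolding cf_equivalent_def by blast
qed

theorem theorem3:
  fixes \<alpha> \<beta> :: real
  assumes "\<alpha> \<notin> \<rat>" and "\<beta> \<notin> \<rat>"
    and "\<alpha> + \<beta> \<notin> \<int>" and "\<alpha> - \<beta> \<notin> \<int>"
    and "\<not> cf_equivalent \<alpha> golden \<or> \<not> cf_equivalent \<beta> golden"
  shows "C_const \<alpha> \<beta> \<ge> ereal (sqrt (sqrt 2 + 1) - 1)"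
proof (rule ccontr)
  assume neg: "\<not> ?thesis"
  let ?f = "irr_measure \<alpha>" and ?g = "irr_measure \<beta>"
  \<comment> \<open>If infinite, \<open>B\<close> would put \<open>crit - 1\<close> among the reals
    whose supremum is \<open>C_const \<alpha> \<beta>\<close>.\<close>
  define B where "B = {t::nat. 1 \<le> t \<and> (crit - 1) * min (?f t) (?g t) \<le> \<bar>?f t - ?g t\<bar>}"
  have "finite B"
  proof (rule ccontr)
    assume "infinite B"
    then have "ereal (crit - 1) \<le> C_const \<alpha> \<beta>"
      unfolding C_const_def B_def by (intro SUP_upper) auto
    then show False using neg by (simp add: crit_def)
  qed
  then obtain T0 where T0: "\<And>t. t \<in> B \<Longrightarrow> t \<le> T0" by (auto simp: finite_nat_set_iff_bounded_le)
  define d where "d = min (dist_int (\<alpha> - \<beta>)) (dist_int (\<alpha> + \<beta>))"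
  have d: "0 < d" using assms dist_int_pos by (simp add: d_def)
  \<comment> \<open>Beyond \<open>T0\<close> balance holds; beyond \<open>2 / d\<close> the estimate
    of \<open>cf_den_congruent\<close> is impossible; the last two entries start both sequences by
    time \<open>T\<close>.\<close>
  define T where "T = max (max (int T0 + 1) (\<lceil>2 / d\<rceil> + 1)) (max (cf_den \<alpha> 1) (cf_den \<beta> 1))"
  interpret A: approx_seq "\<lambda>n. cf_den \<alpha> (Suc n)" "\<lambda>n. cf_err \<alpha> (Suc n)" "\<lambda>n. cf_digit \<alpha> (n + 3)"
    by (rule approx_seq_cf[OF assms(1)])
  interpret B: approx_seq "\<lambda>n. cf_den \<beta> (Suc n)" "\<lambda>n. cf_err \<beta> (Suc n)" "\<lambda>n. cf_digit \<beta> (n + 3)"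
    by (rule approx_seq_cf[OF assms(2)])
  interpret P: approx_pair
    "\<lambda>n. cf_den \<alpha> (Suc n)" "\<lambda>n. cf_err \<alpha> (Suc n)" "\<lambda>n. cf_digit \<alpha> (n + 3)"
    "\<lambda>n. cf_den \<beta> (Suc n)" "\<lambda>n. cf_err \<beta> (Suc n)" "\<lambda>n. cf_digit \<beta> (n + 3)" T
  proof
    show "cf_den \<alpha> (Suc 0) \<le> T" "cf_den \<beta> (Suc 0) \<le> T" by (simp_all add: T_def)
  next
    fix t n m
    assume t: "T \<le> t" "cf_den \<alpha> (Suc n) \<le> t" "t < cf_den \<alpha> (Suc (Suc n))"
      "cf_den \<beta> (Suc m) \<le> t" "t < cf_den \<beta> (Suc (Suc m))"
    have "int T0 < t" using t(1) by (simp add: T_def)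
    then have tt: "1 \<le> nat t" "T0 < nat t" "real (nat t) = of_int t" by auto
    then have "nat t \<notin> B" using T0[of "nat t"] by auto
    then have "\<bar>?f (of_int t) - ?g (of_int t)\<bar> < (crit - 1) * min (?f (of_int t)) (?g (of_int t))"
      using tt by (simp add: B_def)
    moreover have "?f (of_int t) = cf_err \<alpha> (Suc n)" "?g (of_int t) = cf_err \<beta> (Suc m)"
      using irr_measure_eq[OF assms(1) t(2,3)] irr_measure_eq[OF assms(2) t(4,5)] by auto
    ultimately have less: "\<bar>cf_err \<alpha> (Suc n) - cf_err \<beta> (Suc m)\<bar>
        < (crit - 1) * min (cf_err \<alpha> (Suc n)) (cf_err \<beta> (Suc m))"
      by (simp only:)
    have "(crit - 1) * min (cf_err \<alpha> (Suc n)) (cf_err \<beta> (Suc m)) \<le> (crit - 1) * cf_err \<alpha> (Suc n)"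
      "(crit - 1) * min (cf_err \<alpha> (Suc n)) (cf_err \<beta> (Suc m)) \<le> (crit - 1) * cf_err \<beta> (Suc m)"
      using crit_bounds by (intro mult_left_mono; simp)+
    with less show "cf_err \<alpha> (Suc n) < crit * cf_err \<beta> (Suc m) \<and> cf_err \<beta> (Suc m) < crit * cf_err \<alpha> (Suc n)"
      by (simp add: left_diff_distrib abs_less_iff del: cf_err.simps)
  next
    fix n m
    assume eq: "cf_den \<alpha> (Suc n) = cf_den \<beta> (Suc m)" and T: "T \<le> cf_den \<alpha> (Suc n)"
    show "\<not> cf_den \<alpha> (Suc n) dvd cf_den \<alpha> (Suc (Suc n)) - cf_den \<beta> (Suc (Suc m))"
    proof
      assume "cf_den \<alpha> (Suc n) dvd cf_den \<alpha> (Suc (Suc n)) - cf_den \<beta> (Suc (Suc m))"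
      from cf_den_congruent[OF assms(1,2) eq this]
      have "d \<le> 2 / of_int (cf_den \<alpha> (Suc n))" by (auto simp: d_def)
      moreover have "2 / d < of_int (cf_den \<alpha> (Suc n))" using T unfolding T_def by linarith
      ultimately show False
        using d A.q_pos[of n] by (simp add: field_simps)
    qed
  qed
  have "cf_equivalent \<alpha> golden"
    using P.eventually_ones cf_equivalent_golden by blast
  moreover have "cf_equivalent \<beta> golden"
    using approx_pair.eventually_ones[OF P.swap] cf_equivalent_golden by blast
  ultimately show False using assms(5) by blast
qed

end
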